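(* Let $k\ge 2$ be an integer, let $n=3k$, let $\lambda=k\varpi_3=(k,k,k,0,\dots,0)\in\mathbb{Z}^{n}$ and $\mu=(1,1,\dots,1)\in\mathbb{Z}^{n}$. Then the Gelfand--Tsetlin algebra $R'(k\varpi_3,\mu)=\mathbb{C}[S(k\varpi_3,\mu)]$ has essential generators of degree exceeding $2^{n/2-3}$; that is, there exist an integer $d>2^{n/2-3}$ and a nonzero element of degree $d$ in the graded semigroup $S(k\varpi_3,\mu)$ that cannot be written as a sum of two nonzero elements of $S(k\varpi_3,\mu)$.
   Context: A Gelfand--Tsetlin (GT) pattern is a triangular array $\mathbf{x}=(x_{ij})_{1\le i\le j\le n}$ of real numbers satisfying the interlacing inequalities $x_{i,j+1}\ge x_{ij}\ge x_{i+1,j+1}$ for $1\le i\le j\le n-1$. Its top row is $(x_{1n},\dots,x_{nn})$. For $\lambda$ a weakly decreasing sequence of $n$ nonnegative integers and $\mu$ a sequence of $n$ nonnegative integers with the same sum, the GT polytope $GT(\lambda,\mu)$ is the set of real GT patterns with top row $\lambda$ and with row sums $\sum_{i=1}^j x_{ij}=\mu_1+\dots+\mu_j$ for $1\le j\le n$. $S(\lambda,\mu)$ is the semigroup, under entrywise addition, of all integer GT patterns lying in $GT(N\lambda,N\mu)$ for some integer $N\ge 0$; it is graded by $N$. The Gelfand--Tsetlin algebra $R'(\lambda,\mu)$ is (isomorphic to) the graded semigroup algebra $\mathbb{C}[S(\lambda,\mu)]$. An essential generator is a nonzero element of the semigroup that is not a sum of other nonzero elements of the semigroup, so that it must occur in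 every generating set of the semigroup. $\varpi_3=(1,1,1,0,\dots,0)$ is the third fundamental weight of $\mathrm{SL}_n(\mathbb{C})$. *)

theory Defs
  imports Complex_Main "HOL-Library.Function_Algebras"
begin

text \<open>
  A triangular array $(x_{ij})_{1 \le i \le j \le n}$ is a function \<open>x\<close> with \<open>x i j\<close> the $i$-th entry
  of the row of length \<open>j\<close>. Off the triangle it is required to vanish, so that arrays
  correspond bijectively to such functions and the pointwise \<open>+\<close> and \<open>0\<close> on functions are the
  entrywise sum and the zero array. Sequences of length \<open>n\<close> are functions of which only the
  values at \<open>1, \<dots>, n\<close> matter.
\<close>

definition gt_pattern :: "nat \<Rightarrow> (nat \<Rightarrow> nat \<Rightarrow> real) \<Rightarrow> bool" where
  "gt_pattern n x \<longleftrightarrow>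
     (\<forall>i j. 1 \<le> i \<and> i \<le> j \<and> j < n \<longrightarrow> x i (j + 1) \<ge> x i j \<and> x i j \<ge> x (i + 1) (j + 1)) \<and>
     (\<forall>i j. \<not> (1 \<le> i \<and> i \<le> j \<and> j \<le> n) \<longrightarrow> x i j = 0)"

definition gt_polytope ::
    "nat \<Rightarrow> (nat \<Rightarrow> nat) \<Rightarrow> (nat \<Rightarrow> nat) \<Rightarrow> (nat \<Rightarrow> nat \<Rightarrow> real) set" where
  "gt_polytope n lam mu =
     {x. gt_pattern n x \<and>
         (\<forall>i\<in>{1..n}. x i n = real (lam i)) \<and>
         (\<forall>j\<in>{1..n}. (\<Sum>i=1..j. x i j) = (\<Sum>i=1..j. real (mu i)))}"

definition gt_semigroup_deg ::
    "nat \<Rightarrow> (nat \<Rightarrow> nat) \<Rightarrow> (nat \<Rightarrow> nat) \<Rightarrow> nat \<Rightarrow> (nat \<Rightarrow> nat \<Rightarrow> real) set" where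
  "gt_semigroup_deg n lam mu N =
     {x \<in> gt_polytope n (\<lambda>i. N * lam i) (\<lambda>i. N * mu i). \<forall>i j. x i j \<in> \<int>}"

definition gt_semigroup ::
    "nat \<Rightarrow> (nat \<Rightarrow> nat) \<Rightarrow> (nat \<Rightarrow> nat) \<Rightarrow> (nat \<Rightarrow> nat \<Rightarrow> real) set" where
  "gt_semigroup n lam mu = (\<Union>N. gt_semigroup_deg n lam mu N)"

definition essential_generator :: "'a::monoid_add set \<Rightarrow> 'a \<Rightarrow> bool" where
  "essential_generator S x \<longleftrightarrow>
     x \<in> S \<and> x \<noteq> 0 \<and> \<not> (\<exists>y\<in>S. \<exists>z\<in>S. y \<noteq> 0 \<and> z \<noteq> 0 \<and> x = y + z)"

definition fundamental_weight :: "nat \<Rightarrow> nat \<Rightarrow> nat" where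
  "fundamental_weight r i = (if 1 \<le> i \<and> i \<le> r then 1 else 0)"

lemma zero_in_gt_semigroup_deg: "0 \<in> gt_semigroup_deg n lam mu 0"
  by (simp add: gt_semigroup_deg_def gt_polytope_def gt_pattern_def)

lemma gt_semigroup_deg_add:
  assumes "x \<in> gt_semigroup_deg n lam mu M" and "y \<in> gt_semigroup_deg n lam mu N"
  shows "x + y \<in> gt_semigroup_deg n lam mu (M + N)"
  using assms
  by (auto simp: gt_semigroup_deg_def gt_polytope_def gt_pattern_def sum.distrib
      distrib_right intro: add_mono)

end

theory Submission
  imports Defs
begin

text \<open>
  A vertex of the polytope whose entries have a large common denominator $d$ yields an essential
  generator: its smallest integral multiple has degree $d$, and if that multiple is a sum of two
  elements of the semigroup, both summands satisfy with equality every interlacing inequality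
  that the vertex does, so each of them is a multiple of the vertex. It thus suffices to find a
  vertex with exponentially large denominator.

  Only the first three entries of a row can be nonzero, and the row sums leave two degrees of
  freedom per row. The rows used here have, in degree one, the form
  \[ (2m+1-2b_m,\; b_m,\; b_m) \quad\mbox{and}\quad (b_m+1,\; b_{m+1},\; b_m),
     \qquad b_{m+1} = 2m+1-2b_m, \]
  in lengths $2m+1$ and $2m+2$, except for the two shortest and a few of the longest rows. The
  first entry of an odd row becomes the second entry of the next row, which is then repeated as the
  second and third entries of the row after it; hence a perturbation of $b_m$ is multiplied by $-2$
  every two rows. The recursion is repelling, but a
  suitable orbit of it stays within the region where all rows interlace, namely the one that ends
  with the first entry reaching its maximal value $k$ close to the top. This end condition
  determines the orbit; going back to $b_1$ halves once for every two rows, so that $b_1$ has a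
  denominator of order $2^{n/2}$.

  Two things make this precise. First, the inequality $2m-1 \le 3b_m \le 2m+1$ propagates
  downwards, where it sharpens to $2m \le 3b_m \le 2m+1$, and this is what interlacing amounts to
  (\<open>b_bounds\<close>, \<open>interlacing\<close>). Secondly, the equalities among the entries force the recursion and the end
  condition on every summand, and \<open>halving_recursion_closed_form\<close> turns integrality of its
  entries into divisibility of its degree by $d$ (\<open>degree_dvd\<close>).
\<close>

section \<open>Entries of a pattern compared with its top row\<close>

lemma gt_pattern_bounds:
  assumes "gt_pattern n x" and "1 \<le> i" and "i \<le> j" and "j \<le> n"
  shows "x i j \<le> x i n" and "x (i + (n - j)) n \<le> x i j"
proof -
  have "\<forall>i. 1 \<le> i \<and> i \<le> j \<longrightarrow> x i j \<le> x i n \<and> x (i + (n - j)) n \<le> x i j"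
    using \<open>j \<le> n\<close>
  proof (induction j rule: inc_induct)
    case base
    show ?case by simp
  next
    case (step j)
    show ?case
    proof (intro allI impI)
      fix i assume i: "1 \<le> i \<and> i \<le> j"
      have "x i j \<le> x i (j + 1)" "x (i + 1) (j + 1) \<le> x i j"
        using assms(1) i step.hyps by (auto simp: gt_pattern_def)
      moreover have "x i (j + 1) \<le> x i n" "x (i + 1 + (n - (j + 1))) n \<le> x (i + 1) (j + 1)"
        using step.IH i by auto
      moreover have "i + 1 + (n - (j + 1)) = i + (n - j)"
        using step.hyps by simp
      ultimately show "x i j \<le> x i n \<and> x (i + (n - j)) n \<le> x i j"
        by (metis order_trans)
    qed
  qed
  then show "x i j \<le> x i n" "x (i + (n - j)) n \<le> x i j"
    using assms by auto
qed

text \<open>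
  Since the zero array is alone in degree 0, a nontrivial decomposition splits the degree into
  two positive parts.
\<close>

lemma gt_semigroup_deg_0: "gt_semigroup_deg n lam mu 0 = {0}"
proof -
  have "x i j = 0" if x: "x \<in> gt_semigroup_deg n lam mu 0" for x i j
  proof (cases "1 \<le> i \<and> i \<le> j \<and> j \<le> n")
    case True
    have "gt_pattern n x" and top: "\<forall>i\<in>{1..n}. x i n = 0"
      using x by (auto simp: gt_semigroup_deg_def gt_polytope_def)
    then have "x i j \<le> x i n" "x (i + (n - j)) n \<le> x i j"
      using gt_pattern_bounds[of n x i j] True by auto
    moreover have "x i n = 0" "x (i + (n - j)) n = 0"
      using True by (auto intro!: bspec[OF top])
    ultimately show ?thesis by simp
  next
    case False
    then show ?thesis
      using x unfolding gt_semigroup_deg_def gt_polytope_def gt_pattern_def by blast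
  qed
  then show ?thesis
    using zero_in_gt_semigroup_deg by (auto simp: fun_eq_iff)
qed

text \<open>
  The degrees of the summands add up to \<open>d\<close>, as the top left corner shows, so neither of
  them can be a positive multiple of \<open>d\<close>.
\<close>

lemma essential_generator_if_degree_dvd:
  assumes x: "x \<in> gt_semigroup_deg n lam mu d" and "d > 0"
    and lam: "1 \<le> n" "lam 1 > 0"
    and dvd: "\<And>y z N N'. y \<in> gt_semigroup_deg n lam mu N \<Longrightarrow>
      z \<in> gt_semigroup_deg n lam mu N' \<Longrightarrow> x = y + z \<Longrightarrow> d dvd N"
  shows "essential_generator (gt_semigroup n lam mu) x"
proof -
  have corner: "u 1 n = real N * real (lam 1)" if "u \<in> gt_semigroup_deg n lam mu N" for u N
    using that lam(1) by (auto simp: gt_semigroup_deg_def gt_polytope_def)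
  have "x \<noteq> 0"
    using corner[OF x] \<open>d > 0\<close> lam(2) by auto
  moreover have False
    if y: "y \<in> gt_semigroup_deg n lam mu N" "y \<noteq> 0"
      and z: "z \<in> gt_semigroup_deg n lam mu N'" "z \<noteq> 0" and eq: "x = y + z" for y z N N'
  proof -
    have "N > 0" "N' > 0"
      using y z gt_semigroup_deg_0[of n lam mu] by (auto intro!: gr0I)
    have "real d * real (lam 1) = real N * real (lam 1) + real N' * real (lam 1)"
      using corner[OF x] corner[OF y(1)] corner[OF z(1)] eq by simp
    then have "d * lam 1 = (N + N') * lam 1"
      by (metis distrib_right of_nat_add of_nat_eq_iff of_nat_mult)
    then have "d = N + N'"
      using lam(2) by simp
    moreover have "d \<le> N"
      using dvd[OF y(1) z(1) eq] \<open>N > 0\<close> by (rule dvd_imp_le)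
    ultimately show False
      using \<open>N' > 0\<close> by simp
  qed
  ultimately show ?thesis
    using x unfolding essential_generator_def gt_semigroup_def by blast
qed

section \<open>Patterns with three nonzero diagonals\<close>

definition three_row_pattern ::
    "nat \<Rightarrow> (nat \<Rightarrow> real) \<Rightarrow> (nat \<Rightarrow> real) \<Rightarrow> (nat \<Rightarrow> real) \<Rightarrow> nat \<Rightarrow> nat \<Rightarrow> real" where
  "three_row_pattern n A B C i j =
     (if 1 \<le> i \<and> i \<le> j \<and> j \<le> n
      then if i = 1 then A j else if i = 2 then B j else if i = 3 then C j else 0
      else 0)"

text \<open>
  The interlacing hypothesis also covers the positions just outside the triangle in rows 1 and 2.
  It can be met when \<open>B 1\<close>, \<open>C 1\<close> and \<open>C 2\<close> are 0, and it spares a separate treatment of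
  the short rows.
\<close>

lemma gt_pattern_three_row_pattern:
  assumes "\<And>j. 1 \<le> j \<Longrightarrow> j < n \<Longrightarrow>
      A j \<le> A (j + 1) \<and> B (j + 1) \<le> A j \<and> B j \<le> B (j + 1) \<and> C (j + 1) \<le> B j \<and>
      C j \<le> C (j + 1) \<and> 0 \<le> C j"
  shows "gt_pattern n (three_row_pattern n A B C)"
proof -
  have "three_row_pattern n A B C i j \<le> three_row_pattern n A B C i (j + 1) \<and>
    three_row_pattern n A B C (i + 1) (j + 1) \<le> three_row_pattern n A B C i j"
    if "1 \<le> i" "i \<le> j" "j < n" for i j
  proof -
    have "i = 1 \<or> i = 2 \<or> i = 3 \<or> i \<ge> 4"
      using that by linarith
    then show ?thesis
      using assms[of j] that by (elim disjE) (simp_all add: three_row_pattern_def)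
  qed
  then show ?thesis
    by (auto simp: gt_pattern_def three_row_pattern_def)
qed

lemma row_sum_three:
  fixes x :: "nat \<Rightarrow> nat \<Rightarrow> real"
  assumes "\<And>i. i > j \<or> i > 3 \<Longrightarrow> x i j = 0"
  shows "(\<Sum>i=1..j. x i j) = x 1 j + x 2 j + x 3 j"
proof -
  have "(\<Sum>i=1..j. x i j) = (\<Sum>i=1..j + 3. x i j)"
    by (rule sum.mono_neutral_left) (auto simp: assms)
  also have "\<dots> = (\<Sum>i=1..3. x i j)"
    by (rule sum.mono_neutral_right) (auto simp: assms)
  also have "\<dots> = x 1 j + x 2 j + x 3 j"
    by (simp add: numeral_3_eq_3 numeral_2_eq_2)
  finally show ?thesis .
qed

lemma row_sum_three_row_pattern:
  assumes "1 \<le> j" "j \<le> n" and "B 1 = 0" "C 1 = 0" "C 2 = 0"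
  shows "(\<Sum>i=1..j. three_row_pattern n A B C i j) = A j + B j + C j"
proof -
  have "(\<Sum>i=1..j. three_row_pattern n A B C i j) = three_row_pattern n A B C 1 j +
      three_row_pattern n A B C 2 j + three_row_pattern n A B C 3 j"
    by (rule row_sum_three) (auto simp: three_row_pattern_def)
  moreover have "j = 1 \<or> j = 2 \<or> j \<ge> 3"
    using assms(1) by linarith
  ultimately show ?thesis
    using assms by (elim disjE) (simp_all add: three_row_pattern_def)
qed

text \<open>
  Every entry lies between two entries of the top row, which for a position \<open>i > 3\<close> are both 0,
  so that only three entries contribute to a row sum.
\<close>

lemma row_sum_gt_semigroup_deg:
  assumes y: "y \<in> gt_semigroup_deg n (\<lambda>i. k * fundamental_weight 3 i) (\<lambda>i. 1) N"
    and "1 \<le> j" "j \<le> n"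
  shows "y 1 j + y 2 j + y 3 j = real N * real j"
proof -
  have pat: "gt_pattern n y" and top: "\<And>i. 1 \<le> i \<Longrightarrow> i \<le> n \<Longrightarrow> y i n = real (N * (k * fundamental_weight 3 i))"
    and sums: "\<And>j. 1 \<le> j \<Longrightarrow> j \<le> n \<Longrightarrow> (\<Sum>i=1..j. y i j) = real N * real j"
    using y by (auto simp: gt_semigroup_deg_def gt_polytope_def mult.commute)
  have "y i j = 0" if "i > j \<or> i > 3" for i
  proof (cases "i > j")
    case True
    then have "\<not> (1 \<le> i \<and> i \<le> j \<and> j \<le> n)" by simp
    then show ?thesis using pat unfolding gt_pattern_def by blast
  next
    case False
    then have i: "1 \<le> i" "i \<le> j" "i > 3" using that by auto
    have "y i n = 0" "y (i + (n - j)) n = 0"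
      using top[of i] top[of "i + (n - j)"] i assms(3) by (auto simp: fundamental_weight_def)
    then show ?thesis
      using gt_pattern_bounds[OF pat i(1,2) assms(3)] by simp
  qed
  then show ?thesis
    using sums[OF assms(2,3)] row_sum_three[of j y] by simp
qed

section \<open>An expanding recursion\<close>

text \<open>
  The recursion has the particular solution \<open>c * (6 * m + 1) / 9\<close>, and the deviation from it
  is multiplied by \<open>-2\<close> in each step. The factor 9 clears denominators, so that for integral \<open>c\<close>
  and \<open>u 1\<close> the statement is about divisibility by a power of 2.
\<close>

lemma halving_recursion_closed_form:
  fixes u :: "nat \<Rightarrow> real"
  assumes "\<And>m. 1 \<le> m \<Longrightarrow> m < M \<Longrightarrow> u (m + 1) = c * (2 * real m + 1) - 2 * u m"
    and "1 \<le> m" and "m \<le> M"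
  shows "9 * u m - c * (6 * real m + 1) = (-2) ^ (m - 1) * (9 * u 1 - 7 * c)"
  using assms(2,3)
proof (induction m rule: dec_induct)
  case base
  show ?case by simp
next
  case (step m)
  then have "9 * u (m + 1) - c * (6 * real (m + 1) + 1) = -2 * (9 * u m - c * (6 * real m + 1))"
    using assms(1)[of m] by (simp add: algebra_simps)
  also have "9 * u m - c * (6 * real m + 1) = (-2) ^ (m - 1) * (9 * u 1 - 7 * c)"
    using step by simp
  also have "-2 * ((-2) ^ (m - 1) * (9 * u 1 - 7 * c)) = (-2) ^ Suc (m - 1) * (9 * u 1 - 7 * c)"
    by simp
  also have "Suc (m - 1) = Suc m - 1"
    using step.hyps by simp
  finally show ?case by simp
qed

section \<open>A vertex with a large denominator\<close>

text \<open>
  Row \<open>2 * M + 1\<close> is the one whose first entry has reached \<open>k\<close>. Its length must be odd, so that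
  the parity of \<open>k\<close> decides whether there are \<open>q + 1 = 2\<close> or \<open>q + 1 = 3\<close> further rows above it.
\<close>

locale halving_path =
  fixes k q M :: nat
  assumes q: "q = 1 \<or> q = 2" and M: "2 * M + 2 + q = 3 * k" and k: "k \<ge> 2"
begin

abbreviation n :: nat where "n \<equiv> 3 * k"

definition d :: nat where "d = q * 2 ^ (M - 1)"

text \<open>
  Up to index \<open>M\<close> this is the solution of the recursion with \<open>b M = (2 * M + 1 - k) / 2\<close>, the
  value for which row \<open>2 * M + 1\<close> starts with \<open>k\<close>; the coefficient \<open>(3 * q - 1) / 18\<close> is how far
  the particular solution misses it. The other two values extend the rows beyond the range of the
  recursion: \<open>b 0 = 0\<close> gives the zeros in rows 1 and 2, and \<open>b M + 1\<close> lets the second entry grow after the first one is full.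
\<close>

definition b :: "nat \<Rightarrow> real" where
  "b m = (if m = 0 then 0
     else if m \<le> M then (6 * real m + 1) / 9 - real (3 * q - 1) / 18 * ((-2) ^ m / (-2) ^ M)
     else (2 * real M + 1 - real k) / 2 + 1)"

text \<open>
  \<open>A\<close>, \<open>B\<close>, \<open>C\<close> are the first three entries of each row of the vertex, in degree one. The two top
  rows are forced to be \<open>(k, k, k - 1, 0, \<dots>)\<close> and \<open>(k, k, k, 0, \<dots>)\<close>.
\<close>

definition B :: "nat \<Rightarrow> real" where
  "B j = (if j \<ge> n - 1 then real k else b (j div 2))"

definition C :: "nat \<Rightarrow> real" where
  "C j = (if j \<ge> n then real k else if j = n - 1 then real k - 1 else b ((j - 1) div 2))"

definition A :: "nat \<Rightarrow> real" where
  "A j = real j - B j - C j"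

definition x :: "nat \<Rightarrow> nat \<Rightarrow> real" where
  "x = three_row_pattern n (\<lambda>j. real d * A j) (\<lambda>j. real d * B j) (\<lambda>j. real d * C j)"

lemma M_pos: "M \<ge> 1"
  using q M k by linarith

lemma M_real: "2 * real M + 2 + real q = 3 * real k"
  using M by linarith

lemma d_pos: "d > 0"
  using q by (auto simp: d_def)

lemma b_0: "b 0 = 0"
  by (simp add: b_def)

lemma b_M: "b M = (2 * real M + 1 - real k) / 2"
  using q M_pos M_real by (auto simp: b_def field_simps)

lemma b_after_M: "b (M + 1) = b M + 1"
  unfolding b_M by (simp add: b_def)

lemma b_rec: "1 \<le> m \<Longrightarrow> m < M \<Longrightarrow> b (m + 1) = 2 * real m + 1 - 2 * b m"
  by (simp add: b_def field_simps)

text \<open>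
  The recursion read downwards is \<open>b m = (2 * m + 1 - b (m + 1)) / 2\<close>. It reverses and halves
  intervals: the two outer bounds for \<open>m + 1\<close> become \<open>2 * m \<le> 3 * b m \<le> 2 * m + 1\<close>. At the start
  \<open>m = M\<close>, where \<open>b M = k - (1 + q) / 2\<close>, the sharper lower bound fails for \<open>q = 2\<close>.
\<close>

lemma b_bounds:
  assumes "1 \<le> m" "m \<le> M"
  shows "2 * real m - 1 \<le> 3 * b m \<and> 3 * b m \<le> 2 * real m + 1 \<and> (m < M \<longrightarrow> 2 * real m \<le> 3 * b m)"
  using assms(2,1)
proof (induction m rule: inc_induct)
  case base
  show ?case using b_M M_real q by auto
next
  case (step m)
  then show ?case using b_rec[of m] by auto
qed

text \<open>
  \<open>q * b M\<close> is an integer, and each step downwards costs one factor 2. The \<open>M - 1\<close> steps from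
  \<open>M\<close> to 1 explain the value of \<open>d\<close>.
\<close>

lemma b_integral:
  assumes "1 \<le> m" "m \<le> M + 1"
  shows "real d * b m \<in> \<int>"
proof -
  have main: "real q * 2 ^ (M - m) * b m \<in> \<int>" if "1 \<le> m" "m \<le> M" for m
    using that(2,1)
  proof (induction m rule: inc_induct)
    case base
    have "real q * b M = (if q = 1 then of_int (int k - 1) else of_int (2 * int k - 3))"
      using q M_real b_M by (auto simp: field_simps)
    then show ?case by simp
  next
    case (step m)
    have e: "M - m = Suc (M - Suc m)" using step.hyps by simp
    have "2 * b m = real (2 * m + 1) - b (Suc m)"
      using b_rec[of m] step by simp
    moreover have "real q * 2 ^ (M - m) * b m = real q * 2 ^ (M - Suc m) * (2 * b m)"
      by (simp add: e)
    ultimately have "real q * 2 ^ (M - m) * b m =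
      of_nat (q * 2 ^ (M - Suc m) * (2 * m + 1)) - real q * 2 ^ (M - Suc m) * b (Suc m)"
      by (simp only: right_diff_distrib of_nat_mult of_nat_power of_nat_numeral)
    then show ?case
      using step.IH step.prems by simp
  qed
  have "real d * b m \<in> \<int>" if "1 \<le> m" "m \<le> M" for m
  proof -
    have "M - 1 = (M - m) + (m - 1)" using that by simp
    then have "real d = 2 ^ (m - 1) * (real q * 2 ^ (M - m))"
      unfolding d_def by (metis (no_types, lifting) mult.commute mult.left_commute of_nat_mult of_nat_numeral of_nat_power power_add)
    then have "real d * b m = 2 ^ (m - 1) * (real q * 2 ^ (M - m) * b m)"
      by simp
    moreover have "2 ^ (m - 1) * (real q * 2 ^ (M - m) * b m) \<in> \<int>"
      by (intro Ints_mult[OF _ main[OF that]]) simp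
    ultimately show ?thesis by (simp only:)
  qed
  then show ?thesis
    using assms M_pos by (cases "m \<le> M") (auto simp: le_Suc_eq b_after_M[simplified] distrib_left)
qed

lemma start_values: "B 1 = 0" "C 1 = 0" "C 2 = 0"
  using k by (auto simp: B_def C_def b_0)

lemma n_eq: "n = 2 * M + 2 + q"
  using M by simp

lemma below_top_rows: "j \<le> 2 * M + 1 \<Longrightarrow> j < n - 1"
  using q unfolding n_eq by linarith

lemma B_even: "m \<le> M \<Longrightarrow> B (2 * m) = b m"
  and B_odd: "m \<le> M \<Longrightarrow> B (2 * m + 1) = b m"
  using below_top_rows[of "2 * m"] below_top_rows[of "2 * m + 1"] by (simp_all add: B_def)

lemma C_even: "m < M \<Longrightarrow> C (2 * m + 2) = b m"
  and C_odd: "m \<le> M \<Longrightarrow> C (2 * m + 1) = b m"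
  using below_top_rows[of "2 * m + 2"] below_top_rows[of "2 * m + 1"] by (auto simp: C_def)

text \<open>
  For rows of length at least 3, with \<open>a = 2 * m + 1 - 2 * b m\<close>, the inequalities that are not
  equalities follow from \<open>0 \<le> b m\<close> and \<open>b m \<le> a \<le> b m + 1\<close>, and the latter says that
  \<open>2 * m \<le> 3 * b m \<le> 2 * m + 1\<close>.
\<close>

lemma interlacing_lower:
  assumes "1 \<le> j" "j \<le> 2 * M"
  shows "A j \<le> A (j + 1) \<and> B (j + 1) \<le> A j \<and> B j \<le> B (j + 1) \<and> C (j + 1) \<le> B j \<and>
    C j \<le> C (j + 1) \<and> 0 \<le> C j"
proof (cases "even j")
  case True
  then obtain m' where "j = 2 * m'" by (elim evenE)
  then obtain m where m: "j = 2 * m + 2" "m < M"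
    using assms by (cases m') auto
  have vals: "B j = b (m + 1)" "B (j + 1) = b (m + 1)" "C j = b m" "C (j + 1) = b (m + 1)"
    using m B_even[of "m + 1"] B_odd[of "m + 1"] C_even[of m] C_odd[of "m + 1"] q n_eq
    by auto
  show ?thesis
  proof (cases "m = 0")
    case True
    then show ?thesis
      using vals b_bounds[of 1] m M_pos by (auto simp: A_def b_0)
  next
    case False
    then show ?thesis
      using vals b_bounds[of m] b_rec[of m] m by (auto simp: A_def)
  qed
next
  case False
  then obtain m where m: "j = 2 * m + 1" by (elim oddE)
  then have mM: "m < M" using assms by simp
  have vals: "B j = b m" "B (j + 1) = b (m + 1)" "C j = b m" "C (j + 1) = b m"
    using m mM B_even[of "m + 1"] B_odd[of m] C_even[of m] C_odd[of m] q n_eq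
    by auto
  show ?thesis
  proof (cases "m = 0")
    case True
    then show ?thesis
      using vals b_bounds[of 1] m M_pos by (auto simp: A_def b_0)
  next
    case False
    then show ?thesis
      using vals b_bounds[of m] b_rec[of m] m mM by (auto simp: A_def)
  qed
qed

lemma top_rows:
  "A (2 * M + 1) = real k" "B (2 * M + 1) = b M" "C (2 * M + 1) = b M"
  "A (2 * M + 2) = real k" "B (2 * M + 2) = b M + 1" "C (2 * M + 2) = b M"
  "q = 2 \<Longrightarrow> A (2 * M + 3) = real k" "q = 2 \<Longrightarrow> B (2 * M + 3) = real k"
  "q = 2 \<Longrightarrow> C (2 * M + 3) = real k - 1"
  "A n = real k" "B n = real k" "C n = real k"
proof -
  show 1: "B (2 * M + 1) = b M" "C (2 * M + 1) = b M"
    by (rule B_odd C_odd, simp)+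
  then show "A (2 * M + 1) = real k"
    using b_M by (simp add: A_def)
  show 2: "B (2 * M + 2) = b M + 1" "C (2 * M + 2) = b M"
    using q b_M M_real b_after_M unfolding B_def C_def n_eq by auto
  then show "A (2 * M + 2) = real k"
    using b_M by (simp add: A_def field_simps)
  show 3: "q = 2 \<Longrightarrow> B (2 * M + 3) = real k" "q = 2 \<Longrightarrow> C (2 * M + 3) = real k - 1"
    unfolding B_def C_def n_eq by auto
  show "q = 2 \<Longrightarrow> A (2 * M + 3) = real k"
    unfolding A_def using 3 M_real by simp
  show "B n = real k" "C n = real k" by (auto simp: B_def C_def)
  then show "A n = real k" by (simp add: A_def)
qed

lemma interlacing:
  assumes "1 \<le> j" "j < n"
  shows "A j \<le> A (j + 1) \<and> B (j + 1) \<le> A j \<and> B j \<le> B (j + 1) \<and> C (j + 1) \<le> B j \<and>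
    C j \<le> C (j + 1) \<and> 0 \<le> C j"
proof (cases "j \<le> 2 * M")
  case True
  then show ?thesis using interlacing_lower assms by blast
next
  case False
  have bM: "2 * b M = 2 * real k - 1 - real q"
    using b_M M_real by (simp add: field_simps)
  have b_nonneg: "b M \<ge> 0"
    using b_bounds[of M] M_pos by auto
  from False assms q n_eq
  consider "q = 1" "j = 2 * M + 1" "n = 2 * M + 3" | "q = 1" "j = 2 * M + 2" "n = 2 * M + 3"
    | "q = 2" "j = 2 * M + 1" "n = 2 * M + 4" | "q = 2" "j = 2 * M + 2" "n = 2 * M + 4"
    | "q = 2" "j = 2 * M + 3" "n = 2 * M + 4"
    by linarith
  then show ?thesis
  proof cases
    case 1
    then show ?thesis using top_rows bM b_nonneg by simp
  next
    case 2
    then have "j + 1 = n" by simp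
    show ?thesis
      unfolding \<open>j + 1 = n\<close> top_rows(10-12)
      unfolding \<open>j = 2 * M + 2\<close> top_rows(4-6)
      using bM b_nonneg \<open>q = 1\<close> by simp
  next
    case 3
    then show ?thesis using top_rows bM b_nonneg by simp
  next
    case 4
    then have "j + 1 = 2 * M + 3" by simp
    show ?thesis
      unfolding \<open>j + 1 = 2 * M + 3\<close> top_rows(7-9)[OF \<open>q = 2\<close>]
      unfolding \<open>j = 2 * M + 2\<close> top_rows(4-6)
      using bM b_nonneg \<open>q = 2\<close> by simp
  next
    case 5
    then have "j + 1 = n" by simp
    show ?thesis
      unfolding \<open>j + 1 = n\<close> top_rows(10-12)
      unfolding \<open>j = 2 * M + 3\<close> top_rows(7-9)[OF \<open>q = 2\<close>]
      using k by simp
  qed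
qed

lemma x_in_degree_d: "x \<in> gt_semigroup_deg n (\<lambda>i. k * fundamental_weight 3 i) (\<lambda>i. 1) d"
proof -
  have "gt_pattern n x"
    unfolding x_def
  proof (rule gt_pattern_three_row_pattern)
    fix j assume "1 \<le> j" "j < n"
    from interlacing[OF this] show "real d * A j \<le> real d * A (j + 1) \<and>
      real d * B (j + 1) \<le> real d * A j \<and> real d * B j \<le> real d * B (j + 1) \<and>
      real d * C (j + 1) \<le> real d * B j \<and> real d * C j \<le> real d * C (j + 1) \<and> 0 \<le> real d * C j"
      by (simp add: mult_left_mono)
  qed
  moreover have "x i n = real (d * (k * fundamental_weight 3 i))" if "i \<in> {1..n}" for i
  proof -
    have "i = 1 \<or> i = 2 \<or> i = 3 \<or> i \<ge> 4" using that by auto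
    then show ?thesis
      using that k top_rows(10-12)
      by (elim disjE) (simp_all add: x_def three_row_pattern_def fundamental_weight_def)
  qed
  moreover have "(\<Sum>i=1..j. x i j) = (\<Sum>i=1..j. real (d * 1))" if "j \<in> {1..n}" for j
  proof -
    have "(\<Sum>i=1..j. x i j) = real d * A j + real d * B j + real d * C j"
      unfolding x_def by (rule row_sum_three_row_pattern) (use that start_values in auto)
    then show ?thesis by (simp add: A_def algebra_simps)
  qed
  moreover have "x i j \<in> \<int>" for i j
  proof -
    have b_int: "real d * b m \<in> \<int>" if "m \<le> M + 1" for m
      using b_integral[of m] that by (cases "m = 0") (auto simp: b_0)
    have B_int: "real d * B j \<in> \<int>" if "j \<le> n"
      unfolding B_def using that q n_eq
      by (auto intro!: b_int)
    have C_int: "real d * C j \<in> \<int>" if "j \<le> n"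
      unfolding C_def using that q n_eq
      by (auto simp: right_diff_distrib intro!: b_int)
    have A_int: "real d * A j \<in> \<int>" if "j \<le> n"
      using B_int C_int that by (simp add: A_def right_diff_distrib)
    show ?thesis
      using A_int B_int C_int by (auto simp: x_def three_row_pattern_def)
  qed
  ultimately show ?thesis
    by (auto simp: gt_semigroup_deg_def gt_polytope_def)
qed

text \<open>
  The sequence \<open>u\<close> of entries of the summand \<open>y\<close> that correspond to \<open>b\<close> satisfies the same
  recursion and end condition as \<open>b\<close>, scaled by \<open>N\<close>. Comparing the end condition with the closed
  form gives \<open>N * (3 * q - 1) = (-2) ^ M * w\<close> for an integer \<open>w\<close>. The cofactor \<open>3 * q - 1\<close> is 2
  for \<open>q = 1\<close>, which loses one factor 2, and 5 for \<open>q = 2\<close>, which loses none; this matches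
  \<open>d = q * 2 ^ (M - 1)\<close>.
\<close>

lemma degree_dvd:
  assumes y: "y \<in> gt_semigroup_deg n (\<lambda>i. k * fundamental_weight 3 i) (\<lambda>i. 1) N"
    and z: "z \<in> gt_semigroup_deg n (\<lambda>i. k * fundamental_weight 3 i) (\<lambda>i. 1) N'"
    and eq: "x = y + z"
  shows "d dvd N"
proof -
  have pat: "gt_pattern n y" "gt_pattern n z"
    using y z by (auto simp: gt_semigroup_deg_def gt_polytope_def)
  have eq': "x i j = y i j + z i j" for i j
    by (simp add: eq)
  \<comment> \<open>An equality among entries of \<open>x\<close> holds for \<open>y\<close> because \<open>y\<close> and \<open>z\<close> satisfy the same weak
      inequality.\<close>
  have tight_up: "y i j = y i (j + 1)" if "x i j = x i (j + 1)" "1 \<le> i" "i \<le> j" "j < n" for i j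
  proof -
    have "y i j \<le> y i (j + 1)" "z i j \<le> z i (j + 1)"
      using pat that unfolding gt_pattern_def by blast+
    then show ?thesis using that(1) unfolding eq' by linarith
  qed
  have tight_diag: "y (i + 1) (j + 1) = y i j"
    if "x (i + 1) (j + 1) = x i j" "1 \<le> i" "i \<le> j" "j < n" for i j
  proof -
    have "y (i + 1) (j + 1) \<le> y i j" "z (i + 1) (j + 1) \<le> z i j"
      using pat that unfolding gt_pattern_def by blast+
    then show ?thesis using that(1) unfolding eq' by linarith
  qed
  have x_vals: "x 1 j = real d * A j" "2 \<le> j \<Longrightarrow> x 2 j = real d * B j" "3 \<le> j \<Longrightarrow> x 3 j = real d * C j"
    if "1 \<le> j" "j \<le> n" for j
    using that by (auto simp: x_def three_row_pattern_def)
  define u where "u m = y 2 (2 * m)" for m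
  have odd_row: "y 2 (2 * m + 1) = u m \<and> y 3 (2 * m + 1) = u m" if "1 \<le> m" "m \<le> M" for m
  proof -
    have r: "2 * m < n" "2 \<le> 2 * m" using that n_eq by auto
    have "x 2 (2 * m) = x 2 (2 * m + 1)" "x 3 (2 * m + 1) = x 2 (2 * m)"
      using x_vals[of "2 * m"] x_vals[of "2 * m + 1"] r B_even[of m] B_odd[of m] C_odd[of m] that
      by auto
    then show ?thesis
      using tight_up[of 2 "2 * m"] tight_diag[of 2 "2 * m"] r by (simp add: u_def)
  qed
  have row1: "y 1 (2 * m + 1) = real N * (2 * real m + 1) - 2 * u m" if "1 \<le> m" "m \<le> M" for m
  proof -
    have "y 1 (2 * m + 1) + y 2 (2 * m + 1) + y 3 (2 * m + 1) = real N * real (2 * m + 1)"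
      by (rule row_sum_gt_semigroup_deg[OF y]) (use that n_eq in auto)
    then show ?thesis using odd_row[OF that] by (simp add: algebra_simps)
  qed
  have rec: "u (m + 1) = real N * (2 * real m + 1) - 2 * u m" if "1 \<le> m" "m < M" for m
  proof -
    have r: "2 * m + 1 < n" using that n_eq by auto
    have "A (2 * m + 1) = b (m + 1)"
      using b_rec[of m] B_odd[of m] C_odd[of m] that by (simp add: A_def)
    then have "x (1 + 1) (2 * m + 1 + 1) = x 1 (2 * m + 1)"
      using x_vals(1)[of "2 * m + 1"] x_vals(2)[of "2 * m + 2"] r B_even[of "m + 1"] that
      by (simp add: numeral_2_eq_2)
    then have "y (1 + 1) (2 * m + 1 + 1) = y 1 (2 * m + 1)"
      by (rule tight_diag) (use r in auto)
    moreover have "u (m + 1) = y (1 + 1) (2 * m + 1 + 1)"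
      by (simp add: u_def numeral_2_eq_2)
    ultimately show ?thesis using row1[of m] that by simp
  qed
  have last: "real N * real k = real N * (2 * real M + 1) - 2 * u M"
  proof -
    have r: "1 \<le> 2 * M + 1" "2 * M + 1 \<le> n" "1 \<le> n" using n_eq by auto
    have "x 1 (2 * M + 1) = x 1 n"
      using x_vals(1)[of "2 * M + 1"] x_vals(1)[of n] r top_rows(1,10) by simp
    moreover have "y 1 (2 * M + 1) \<le> y 1 n" "z 1 (2 * M + 1) \<le> z 1 n"
      using gt_pattern_bounds(1) pat r by auto
    ultimately have "y 1 (2 * M + 1) = y 1 n"
      unfolding eq' by linarith
    moreover have "y 1 n = real N * real k"
      using y r by (auto simp: gt_semigroup_deg_def gt_polytope_def fundamental_weight_def)
    ultimately show ?thesis using row1[of M] M_pos by simp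
  qed
  have "u 1 \<in> \<int>"
    using y by (simp add: gt_semigroup_deg_def u_def)
  then obtain v :: int where v: "u 1 = of_int v"
    by (elim Ints_cases)
  have "9 * u M - real N * (6 * real M + 1) = (-2) ^ (M - 1) * (9 * u 1 - 7 * real N)"
    by (rule halving_recursion_closed_form[OF rec]) (use M_pos in auto)
  moreover have "2 * (9 * u M - real N * (6 * real M + 1)) = - (real N * (3 * real q - 1))"
  proof -
    have "2 * (9 * u M - real N * (6 * real M + 1)) = 
        real N * (9 * (2 * real M + 1 - real k) - 2 * (6 * real M + 1))"
      using last by (simp add: algebra_simps)
    also have "9 * (2 * real M + 1 - real k) - 2 * (6 * real M + 1) = - (3 * real q - 1)"
      using M_real by simp
    finally show ?thesis by (simp add: algebra_simps)
  qed
  moreover have "(-2 :: real) ^ M = -2 * (-2) ^ (M - 1)"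
    using M_pos by (cases M) auto
  ultimately have "real N * (3 * real q - 1) = (-2) ^ M * (9 * u 1 - 7 * real N)"
    by simp
  then have "real_of_int (int N * (3 * int q - 1)) = of_int ((-2) ^ M * (9 * v - 7 * int N))"
    by (simp add: v[simplified])
  then have "int N * (3 * int q - 1) = (-2) ^ M * (9 * v - 7 * int N)"
    by (simp only: of_int_eq_iff)
  then have "(-2) ^ M dvd int N * (3 * int q - 1)"
    by simp
  then have dv: "int (2 ^ M) dvd int N * (3 * int q - 1)"
    by (cases "even M") (auto simp: power_minus_odd)
  show "d dvd N"
    using q
  proof
    assume "q = 1"
    then have "int (2 ^ M) dvd int (N * 2)" using dv by simp
    then have "2 ^ M dvd N * 2" by (simp only: int_dvd_int_iff)
    moreover have "2 ^ M = 2 ^ (M - 1) * (2::nat)" using M_pos by (cases M) auto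
    ultimately show ?thesis unfolding d_def using \<open>q = 1\<close> by simp
  next
    assume "q = 2"
    then have "int (2 ^ M) dvd int (N * 5)" using dv by simp
    then have "2 ^ M dvd N * 5" by (simp only: int_dvd_int_iff)
    moreover have "coprime (2 ^ M) (5::nat)" by simp
    ultimately have "2 ^ M dvd N" by (simp add: coprime_dvd_mult_left_iff)
    moreover have "2 ^ M = 2 * (2::nat) ^ (M - 1)" using M_pos by (cases M) auto
    ultimately show ?thesis unfolding d_def using \<open>q = 2\<close> by simp
  qed
qed

lemma d_large: "2 powr (real n / 2 - 3) < real d"
proof -
  have n: "real n = 2 * real M + 2 + real q"
    using n_eq by simp
  show ?thesis
    using q
  proof
    assume "q = 1"
    then have "2 powr (real n / 2 - 3) < 2 powr real (M - 1)"
      using n M_pos by (simp add: of_nat_diff)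
    also have "\<dots> = real d"
      unfolding d_def using \<open>q = 1\<close> by (simp add: powr_realpow)
    finally show ?thesis .
  next
    assume "q = 2"
    then have "2 powr (real n / 2 - 3) < 2 powr real M"
      using n by (simp add: field_simps)
    also have "\<dots> = 2 ^ M"
      by (simp add: powr_realpow)
    also have "\<dots> = real d"
      unfolding d_def using \<open>q = 2\<close> M_pos by (cases M) simp_all
    finally show ?thesis .
  qed
qed

end

theorem theorem5p0p2:
  fixes k n :: nat and lam mu :: "nat \<Rightarrow> nat"
  assumes "k \<ge> 2" and "n = 3 * k"
    and "lam = (\<lambda>i. k * fundamental_weight 3 i)" and "mu = (\<lambda>i. 1)"
  shows "\<exists>d x. real d > 2 powr (real n / 2 - 3) \<and>
    x \<in> gt_semigroup_deg n lam mu d \<and> essential_generator (gt_semigroup n lam mu) x"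
proof -
  obtain q M where "q = 1 \<or> q = 2" "2 * M + 2 + q = 3 * k"
  proof (cases "even k")
    case True
    then have "2 * ((3 * k - 4) div 2) + 2 + 2 = 3 * k"
      using assms(1) by (auto elim!: evenE)
    then show ?thesis using that[of 2 "(3 * k - 4) div 2"] by simp
  next
    case False
    then have "2 * ((3 * k - 3) div 2) + 2 + 1 = 3 * k"
      using assms(1) by (auto elim!: oddE)
    then show ?thesis using that[of 1 "(3 * k - 3) div 2"] by simp
  qed
  then interpret path: halving_path k q M
    by unfold_locales (use assms(1) in auto)
  have "essential_generator (gt_semigroup n lam mu) path.x"
    unfolding assms(2-)
    using path.x_in_degree_d path.d_pos
    by (rule essential_generator_if_degree_dvd)
      (use assms(1) path.degree_dvd in \<open>auto simp: fundamental_weight_def\<close>)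
  then show ?thesis
    using path.d_large path.x_in_degree_d unfolding assms(2-) by blast
qed

end
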